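(* Let $C$ be a compact convex subset of $\mathbb{R}^n$ and let $m\in \mathbb{N}\cup\{\infty\}$, $m\geq 2$. If $f\in C^{m}(\mathbb{R}^n)$ satisfies $(CW^{k})$ with a strict inequality on $\partial C$ for some finite $k$ with $2\le k\leq m$, then $f$ satisfies $(CW^p)$ on $\partial C$ for every $p\in\{2, \ldots, m\}$, if $m$ is finite, and for every $p\in\mathbb{N}$ with $p\geq 2$, if $m=\infty$.
   Context: $\mathbb{S}^{n-1}$ is the Euclidean unit sphere of $\mathbb{R}^n$. $D^{j}f(y)(w^{j-2},v^2)$ denotes the $j$-th derivative of $f$ at $y$, as a symmetric $j$-linear form, evaluated with $w$ repeated $j-2$ times and $v$ repeated twice. For an integer $p\ge2$ and $f$ of class $C^p$, and a set $S\subset\mathbb{R}^n$: $f$ satisfies $(CW^p)$ on $S$ if for every $\varepsilon>0$ there exists $t_\varepsilon>0$ such that $$D^2f(y)(v^2)+ t\, D^3f(y)(w,v^2)+ \cdots + \frac{t^{p-2}}{(p-2)!} D^{p}f(y)(w^{p-2},v^2) \geq -\varepsilon t^{p-2}$$ for all $y\in S$, $v,w\in\mathbb{S}^{n-1}$, $0<t\le t_\varepsilon$. $f$ satisfies $(CW^p)$ with a strict inequality on $S$ if there are $\eta>0$ and $t_0>0$ such that $$D^2f(y)(v^2)+ t\, D^3f(y)(w,v^2)+ \cdots + \frac{t^{p-2}}{(p-2)!} D^{p}f(y)(w^{p-2},v^2) \geq \eta t^{p-2}$$ for all $y\in S$, $v,w\in\mathbb{S}^{n-1}$, $0<t\le t_0$.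 *)

theory Defs
  imports "HOL-Analysis.Analysis" "HOL-Library.Extended_Nat"
begin

text \<open>
  \<open>nth_deriv f [v\<^sub>1, \<dots>, v\<^sub>j] y\<close> is $D^j f(y)(v_1, \dots, v_j)$. The order of the derivative is
  the length of the list, and $D^{j+1} f(y)(v, v_1, \dots, v_j)$ is the derivative of
  $x \mapsto D^j f(x)(v_1, \dots, v_j)$ at $y$ in the direction $v$.
\<close>

primrec nth_deriv :: "('a::real_normed_vector \<Rightarrow> real) \<Rightarrow> 'a list \<Rightarrow> 'a \<Rightarrow> real" where
  "nth_deriv f [] = f"
| "nth_deriv f (v # vs) = (\<lambda>x. frechet_derivative (nth_deriv f vs) (at x) v)"

text \<open>
  The space of $j$-linear forms on a Euclidean space is finite-dimensional, so the map
  $x \mapsto D^j f(x)$ is Frechet differentiable (continuous) iff $x \mapsto D^j f(x)(v_1, \dots, v_j)$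
  is so for all fixed $v_1, \dots, v_j$.
\<close>

definition class_C :: "enat \<Rightarrow> ('a::euclidean_space \<Rightarrow> real) \<Rightarrow> bool" where
  "class_C m f \<longleftrightarrow>
     (\<forall>vs. enat (length vs) < m \<longrightarrow> nth_deriv f vs differentiable_on UNIV) \<and>
     (\<forall>vs. enat (length vs) \<le> m \<longrightarrow> continuous_on UNIV (nth_deriv f vs))"

definition CW_sum :: "nat \<Rightarrow> ('a::euclidean_space \<Rightarrow> real) \<Rightarrow> 'a \<Rightarrow> 'a \<Rightarrow> 'a \<Rightarrow> real \<Rightarrow> real" where
  "CW_sum p f y v w t =
     (\<Sum>j = 2..p. t ^ (j - 2) / fact (j - 2) * nth_deriv f (replicate (j - 2) w @ [v, v]) y)"

text \<open>The following two notions are meant for \<open>p \<ge> 2\<close> and \<open>f\<close> of class $C^p$.\<close>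

definition CW :: "nat \<Rightarrow> ('a::euclidean_space \<Rightarrow> real) \<Rightarrow> 'a set \<Rightarrow> bool" where
  "CW p f S \<longleftrightarrow>
     (\<forall>\<epsilon>>0. \<exists>t\<^sub>\<epsilon>>0. \<forall>y\<in>S. \<forall>v\<in>sphere 0 1. \<forall>w\<in>sphere 0 1. \<forall>t. 0 < t \<and> t \<le> t\<^sub>\<epsilon> \<longrightarrow>
        CW_sum p f y v w t \<ge> - \<epsilon> * t ^ (p - 2))"

definition CW_strict :: "nat \<Rightarrow> ('a::euclidean_space \<Rightarrow> real) \<Rightarrow> 'a set \<Rightarrow> bool" where
  "CW_strict p f S \<longleftrightarrow>
     (\<exists>\<eta>>0. \<exists>t\<^sub>0>0. \<forall>y\<in>S. \<forall>v\<in>sphere 0 1. \<forall>w\<in>sphere 0 1. \<forall>t. 0 < t \<and> t \<le> t\<^sub>0 \<longrightarrow>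
        CW_sum p f y v w t \<ge> \<eta> * t ^ (p - 2))"

end

theory Submission
  imports Defs
begin

text \<open>
  Each derivative of order at most \<open>m\<close> is bounded on the compact set \<open>frontier C\<close>, uniformly
  over unit vectors. Hence, for \<open>2 \<le> q \<le> r\<close> with \<open>r\<close> finite and at most \<open>m\<close>, the sums
  \<open>CW_sum q\<close> and \<open>CW_sum r\<close> differ by at most \<open>M t\<^bsup>q-1\<^esup>\<close> for \<open>0 < t \<le> 1\<close>, which is of smaller
  order than \<open>t\<^bsup>q-2\<^esup>\<close> as \<open>t\<close> tends to 0: this is \<open>CW_sum_diff_bound\<close>.

  Let \<open>t\<close> be small enough for the strict inequality to hold.
  If \<open>p < k\<close>, \<open>CW_sum k\<close> is positive, so \<open>CW_sum p\<close> is at least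
  \<open>- M t\<^bsup>p-1\<^esup> \<ge> - \<epsilon> t\<^bsup>p-2\<^esup>\<close> once \<open>M t \<le> \<epsilon>\<close>. If \<open>k \<le> p\<close>, \<open>CW_sum p\<close> is at least
  \<open>\<eta> t\<^bsup>k-2\<^esup> - M t\<^bsup>k-1\<^esup> \<ge> 0\<close> once \<open>M t \<le> \<eta>\<close>.

  The uniform bound (\<open>nth_deriv_bounded_on_compact\<close>) follows from linearity in each direction: it
  reduces the bound to the finitely many partial derivatives, each of them continuous.
\<close>

text \<open>
  In the first slot this is linearity of the Frechet derivative. Further differentiations
  preserve the identity, since they commute with finite linear combinations.
\<close>

lemma nth_deriv_expand_slot:
  fixes f :: "'a::euclidean_space \<Rightarrow> real"
  assumes "class_C m f" and "enat (length (us @ u # ws)) \<le> m"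
  shows "nth_deriv f (us @ u # ws) y = (\<Sum>b\<in>Basis. (u \<bullet> b) * nth_deriv f (us @ b # ws) y)"
  using assms(2)
proof (induction us arbitrary: y)
  case Nil
  then have "enat (length ws) < m"
    by (simp add: Suc_ile_eq)
  then have "nth_deriv f ws differentiable (at y)"
    using assms(1) by (auto simp: class_C_def differentiable_on_def)
  then have lin: "linear (frechet_derivative (nth_deriv f ws) (at y))"
    by (rule linear_frechet_derivative)
  have "frechet_derivative (nth_deriv f ws) (at y) u
      = frechet_derivative (nth_deriv f ws) (at y) (\<Sum>b\<in>Basis. (u \<bullet> b) *\<^sub>R b)"
    by (simp add: euclidean_representation)
  also have "\<dots> = (\<Sum>b\<in>Basis. (u \<bullet> b) * frechet_derivative (nth_deriv f ws) (at y) b)"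
    by (simp add: linear_sum[OF lin] linear_scale[OF lin])
  finally show ?case by simp
next
  case (Cons a us)
  then have less: "enat (length (us @ u # ws)) < m"
    by (simp add: Suc_ile_eq)
  have diff: "nth_deriv f (us @ b # ws) differentiable (at y)" for b
  proof -
    have "enat (length (us @ b # ws)) < m"
      using less by simp
    then show ?thesis
      using assms(1) unfolding class_C_def differentiable_on_def by blast
  qed
  have eq: "nth_deriv f (us @ u # ws)
      = (\<lambda>x. \<Sum>b\<in>Basis. (u \<bullet> b) * nth_deriv f (us @ b # ws) x)"
    using Cons.IH less by (intro ext) simp
  have "((\<lambda>x. \<Sum>b\<in>Basis. (u \<bullet> b) * nth_deriv f (us @ b # ws) x) has_derivative
      (\<lambda>h. \<Sum>b\<in>Basis. (u \<bullet> b) * frechet_derivative (nth_deriv f (us @ b # ws)) (at y) h)) (at y)"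
    by (intro has_derivative_sum has_derivative_mult_right)
      (use diff frechet_derivative_works in blast)
  then have "frechet_derivative (nth_deriv f (us @ u # ws)) (at y)
      = (\<lambda>h. \<Sum>b\<in>Basis. (u \<bullet> b) * frechet_derivative (nth_deriv f (us @ b # ws)) (at y) h)"
    unfolding eq by (rule frechet_derivative_at[symmetric])
  then show ?case by simp
qed

text \<open>
  The fixed directions \<open>ws\<close> make the induction work: it expands the last varying direction in the
  basis and moves it, now a basis vector, to the fixed ones.
\<close>

lemma nth_deriv_bounded_with_fixed_directions:
  fixes f :: "'a::euclidean_space \<Rightarrow> real"
  assumes "class_C m f" and "compact K" and "enat (i + length ws) \<le> m"
  shows "\<exists>M. \<forall>us y. length us = i \<longrightarrow> set us \<subseteq> cball 0 1 \<longrightarrow> y \<in> K \<longrightarrow>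
    \<bar>nth_deriv f (us @ ws) y\<bar> \<le> M"
  using assms(3)
proof (induction i arbitrary: ws)
  case 0
  then have "continuous_on K (nth_deriv f ws)"
    using assms(1) unfolding class_C_def by (metis add_0 continuous_on_subset subset_UNIV)
  then have "bounded (nth_deriv f ws ` K)"
    using assms(2) by (intro compact_imp_bounded compact_continuous_image)
  then show ?case by (auto simp: bounded_iff)
next
  case (Suc i)
  have "\<exists>M. \<forall>us y. length us = i \<longrightarrow> set us \<subseteq> cball 0 1 \<longrightarrow> y \<in> K \<longrightarrow>
      \<bar>nth_deriv f (us @ b # ws) y\<bar> \<le> M" for b
    using Suc.IH[of "b # ws"] Suc.prems by simp
  then obtain M where M: "\<And>b us y. length us = i \<Longrightarrow> set us \<subseteq> cball 0 1 \<Longrightarrow> y \<in> K \<Longrightarrow>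
      \<bar>nth_deriv f (us @ b # ws) y\<bar> \<le> M b"
    by metis
  have "\<bar>nth_deriv f (vs @ ws) y\<bar> \<le> (\<Sum>b\<in>Basis. M b)"
    if vs: "length vs = Suc i" "set vs \<subseteq> cball 0 1" and y: "y \<in> K" for vs y
  proof -
    obtain us u where us: "vs = us @ [u]" "length us = i"
      using vs(1) by (metis length_Suc_conv_rev)
    have "\<bar>(u \<bullet> b) * nth_deriv f (us @ b # ws) y\<bar> \<le> M b" if "b \<in> Basis" for b
    proof -
      have "\<bar>u \<bullet> b\<bar> \<le> 1"
        using Basis_le_norm[OF that, of u] vs(2) us(1) by simp
      then have "\<bar>u \<bullet> b\<bar> * \<bar>nth_deriv f (us @ b # ws) y\<bar> \<le> \<bar>nth_deriv f (us @ b # ws) y\<bar>"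
        by (intro mult_left_le_one_le) auto
      also have "\<dots> \<le> M b"
        using M us vs(2) y by auto
      finally show ?thesis by (simp add: abs_mult)
    qed
    then have "\<bar>\<Sum>b\<in>Basis. (u \<bullet> b) * nth_deriv f (us @ b # ws) y\<bar> \<le> (\<Sum>b\<in>Basis. M b)"
      by (intro order_trans[OF sum_abs] sum_mono)
    moreover have "enat (length (us @ u # ws)) \<le> m"
      using Suc.prems us(2) by simp
    ultimately show ?thesis
      using nth_deriv_expand_slot[OF assms(1)] us(1) by simp
  qed
  then show ?case by blast
qed

lemma nth_deriv_bounded_on_compact:
  fixes f :: "'a::euclidean_space \<Rightarrow> real"
  assumes "class_C m f" and "compact K" and "enat j \<le> m"
  obtains M where "\<And>us y. length us = j \<Longrightarrow> set us \<subseteq> cball 0 1 \<Longrightarrow> y \<in> K \<Longrightarrow>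
    \<bar>nth_deriv f us y\<bar> \<le> M"
  using nth_deriv_bounded_with_fixed_directions[of m f K j "[]"] assms by auto

lemma CW_sum_diff_bound:
  fixes f :: "'a::euclidean_space \<Rightarrow> real"
  assumes "class_C m f" and "compact K" and "2 \<le> q" and "q \<le> r" and "enat r \<le> m"
  obtains M where "M > 0" and
    "\<And>y v w t. y \<in> K \<Longrightarrow> v \<in> sphere 0 1 \<Longrightarrow> w \<in> sphere 0 1 \<Longrightarrow> 0 < t \<Longrightarrow> t \<le> 1 \<Longrightarrow>
      \<bar>CW_sum r f y v w t - CW_sum q f y v w t\<bar> \<le> M * t * t ^ (q - 2)"
proof -
  have "\<exists>B. \<forall>us y. length us = j \<longrightarrow> set us \<subseteq> cball 0 1 \<longrightarrow> y \<in> K \<longrightarrow>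
      \<bar>nth_deriv f us y\<bar> \<le> B" if "j \<le> r" for j
  proof -
    have "enat j \<le> m"
      using that assms(5) by (meson enat_ord_simps(1) order_trans)
    then show ?thesis
      by (rule nth_deriv_bounded_on_compact[OF assms(1,2)]) blast
  qed
  then obtain B where B: "\<And>j us y. j \<le> r \<Longrightarrow> length us = j \<Longrightarrow> set us \<subseteq> cball 0 1 \<Longrightarrow> y \<in> K \<Longrightarrow>
      \<bar>nth_deriv f us y\<bar> \<le> B j"
    by metis
  define M where "M = (\<Sum>j\<in>{q<..r}. \<bar>B j\<bar>) + 1"
  show thesis
  proof (rule that)
    show "M > 0"
      unfolding M_def by (intro add_nonneg_pos sum_nonneg) auto
    fix y v w :: 'a and t :: real
    assume y: "y \<in> K" and v: "v \<in> sphere 0 1" and w: "w \<in> sphere 0 1" and t: "0 < t" "t \<le> 1"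
    let ?a = "\<lambda>j. t ^ (j - 2) / fact (j - 2) * nth_deriv f (replicate (j - 2) w @ [v, v]) y"
    have "{2..r} = {2..q} \<union> {q<..r}"
      using assms(3,4) by auto
    then have "CW_sum r f y v w t = CW_sum q f y v w t + (\<Sum>j\<in>{q<..r}. ?a j)"
      unfolding CW_sum_def by (simp add: sum.union_disjoint ivl_disj_int)
    then have "\<bar>CW_sum r f y v w t - CW_sum q f y v w t\<bar> \<le> (\<Sum>j\<in>{q<..r}. \<bar>?a j\<bar>)"
      by (simp only: add_diff_cancel_left' sum_abs)
    also have "\<dots> \<le> (\<Sum>j\<in>{q<..r}. t ^ (q - 1) * \<bar>B j\<bar>)"
    proof (rule sum_mono)
      fix j assume j: "j \<in> {q<..r}"
      have "t ^ (j - 2) / fact (j - 2) \<le> t ^ (j - 2)"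
        using t by (simp add: divide_le_eq mult_le_cancel_left1)
      also have "\<dots> \<le> t ^ (q - 1)"
        using t j by (intro power_decreasing) auto
      finally have coeff: "t ^ (j - 2) / fact (j - 2) \<le> t ^ (q - 1)" .
      have "\<bar>nth_deriv f (replicate (j - 2) w @ [v, v]) y\<bar> \<le> B j"
        using j assms(3) v w y by (intro B) auto
      then have "\<bar>nth_deriv f (replicate (j - 2) w @ [v, v]) y\<bar> \<le> \<bar>B j\<bar>"
        by simp
      with coeff have "t ^ (j - 2) / fact (j - 2) * \<bar>nth_deriv f (replicate (j - 2) w @ [v, v]) y\<bar>
          \<le> t ^ (q - 1) * \<bar>B j\<bar>"
        using t by (intro mult_mono) auto
      then show "\<bar>?a j\<bar> \<le> t ^ (q - 1) * \<bar>B j\<bar>"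
        using t by (simp add: abs_mult)
    qed
    also have "\<dots> \<le> t ^ (q - 1) * M"
      using t by (simp add: M_def flip: sum_distrib_left)
    also have "q - 1 = Suc (q - 2)"
      using assms(3) by simp
    finally show "\<bar>CW_sum r f y v w t - CW_sum q f y v w t\<bar> \<le> M * t * t ^ (q - 2)"
      by (simp add: mult.commute mult.left_commute)
  qed
qed

theorem proposition1p6:
  fixes f :: "real ^ 'n \<Rightarrow> real" and C :: "(real ^ 'n) set" and m :: enat and k :: nat
  assumes "compact C" and "convex C"
    and "m \<ge> 2"
    and "class_C m f"
    and "2 \<le> k" and "enat k \<le> m"
    and "CW_strict k f (frontier C)"
  shows "\<forall>p::nat. 2 \<le> p \<and> enat p \<le> m \<longrightarrow> CW p f (frontier C)"
proof (intro allI impI)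
  fix p :: nat
  assume p: "2 \<le> p \<and> enat p \<le> m"
  have K: "compact (frontier C)"
    using assms(1) by (rule compact_frontier)
  obtain \<eta> t\<^sub>0 where "\<eta> > 0" "t\<^sub>0 > 0" and strict:
    "\<And>y v w t. y \<in> frontier C \<Longrightarrow> v \<in> sphere 0 1 \<Longrightarrow> w \<in> sphere 0 1 \<Longrightarrow> 0 < t \<Longrightarrow> t \<le> t\<^sub>0 \<Longrightarrow>
      CW_sum k f y v w t \<ge> \<eta> * t ^ (k - 2)"
    using assms(7) unfolding CW_strict_def by blast
  show "CW p f (frontier C)"
    unfolding CW_def
  proof (intro allI impI)
    fix \<epsilon> :: real
    assume "\<epsilon> > 0"
    show "\<exists>t\<^sub>\<epsilon>>0. \<forall>y\<in>frontier C. \<forall>v\<in>sphere 0 1. \<forall>w\<in>sphere 0 1. \<forall>t. 0 < t \<and> t \<le> t\<^sub>\<epsilon> \<longrightarrow>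
        CW_sum p f y v w t \<ge> - \<epsilon> * t ^ (p - 2)"
    proof (cases "p < k")
      case True
      then obtain M where "M > 0" and M:
        "\<And>y v w t. y \<in> frontier C \<Longrightarrow> v \<in> sphere 0 1 \<Longrightarrow> w \<in> sphere 0 1 \<Longrightarrow> 0 < t \<Longrightarrow> t \<le> 1 \<Longrightarrow>
          \<bar>CW_sum k f y v w t - CW_sum p f y v w t\<bar> \<le> M * t * t ^ (p - 2)"
        using CW_sum_diff_bound[OF assms(4) K, of p k] p assms(6) by auto
      have "CW_sum p f y v w t \<ge> - \<epsilon> * t ^ (p - 2)"
        if "y \<in> frontier C" "v \<in> sphere 0 1" "w \<in> sphere 0 1" "0 < t"
          and t: "t \<le> min (min t\<^sub>0 1) (\<epsilon> / M)" for y v w t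
      proof -
        have "t \<le> t\<^sub>0" "t \<le> 1"
          using t by auto
        have "M * t \<le> \<epsilon>"
          using t \<open>M > 0\<close> by (simp add: pos_le_divide_eq mult.commute)
        then have "M * t * t ^ (p - 2) \<le> \<epsilon> * t ^ (p - 2)"
          using \<open>0 < t\<close> by (intro mult_right_mono) auto
        moreover have "0 \<le> \<eta> * t ^ (k - 2)"
          using \<open>\<eta> > 0\<close> \<open>0 < t\<close> by simp
        ultimately show ?thesis
          using strict[OF that(1-4)] M[OF that(1-4)] \<open>t \<le> t\<^sub>0\<close> \<open>t \<le> 1\<close> by linarith
      qed
      moreover have "min (min t\<^sub>0 1) (\<epsilon> / M) > 0"
        using \<open>t\<^sub>0 > 0\<close> \<open>\<epsilon> > 0\<close> \<open>M > 0\<close> by simp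
      ultimately show ?thesis by blast
    next
      case False
      then obtain M where "M > 0" and M:
        "\<And>y v w t. y \<in> frontier C \<Longrightarrow> v \<in> sphere 0 1 \<Longrightarrow> w \<in> sphere 0 1 \<Longrightarrow> 0 < t \<Longrightarrow> t \<le> 1 \<Longrightarrow>
          \<bar>CW_sum p f y v w t - CW_sum k f y v w t\<bar> \<le> M * t * t ^ (k - 2)"
        using CW_sum_diff_bound[OF assms(4) K, of k p] p assms(5) by auto
      have "CW_sum p f y v w t \<ge> - \<epsilon> * t ^ (p - 2)"
        if "y \<in> frontier C" "v \<in> sphere 0 1" "w \<in> sphere 0 1" "0 < t"
          and t: "t \<le> min (min t\<^sub>0 1) (\<eta> / M)" for y v w t
      proof -
        have "t \<le> t\<^sub>0" "t \<le> 1"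
          using t by auto
        have "M * t \<le> \<eta>"
          using t \<open>M > 0\<close> by (simp add: pos_le_divide_eq mult.commute)
        then have "M * t * t ^ (k - 2) \<le> \<eta> * t ^ (k - 2)"
          using \<open>0 < t\<close> by (intro mult_right_mono) auto
        moreover have "0 \<le> \<epsilon> * t ^ (p - 2)"
          using \<open>\<epsilon> > 0\<close> \<open>0 < t\<close> by simp
        ultimately show ?thesis
          using strict[OF that(1-4)] M[OF that(1-4)] \<open>t \<le> t\<^sub>0\<close> \<open>t \<le> 1\<close> by linarith
      qed
      moreover have "min (min t\<^sub>0 1) (\<eta> / M) > 0"
        using \<open>t\<^sub>0 > 0\<close> \<open>\<eta> > 0\<close> \<open>M > 0\<close> by simp
      ultimately show ?thesis by blast
    qed
  qed
qed

end
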